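(* Let $1<p<\infty$. Suppose that for every $f\in H^p$ with $f(0)\ne0$ and every non-constant inner function $J$ with $J(0)\ne0$ there exists a constant $c\in\mathbb{C}\setminus\{0\}$ such that $$\|1-Jf\|_p\ge\|1-cf\|_p.$$ Then any non-trivial (i.e. not identically zero) optimal polynomial approximant in $H^p$ cannot vanish in the open unit disk; that is, for every $g\in H^p$ with $g(0)\ne0$ and every $n\in\mathbb{N}$, if $q_{n,p}[g]$ is not identically zero then it has no zeros in $\mathbb{D}$.
   Context: $\mathbb{N}=\{0,1,2,\dots\}$ and $\mathbb{D}$ is the open unit disk. $H^p$ is the Hardy space of analytic functions on $\mathbb{D}$ with norm $\|f\|_p^p=\sup_{0<r<1}\frac1{2\pi}\int_0^{2\pi}|f(re^{i\theta})|^p\,d\theta$. A function in $H^\infty$ is inner if its boundary values have modulus $1$ a.e. on the unit circle. $\mathcal{P}_n$ is the set of complex polynomials of degree at most $n$. For $g\in H^p$ with $g(0)\ne0$, the $n$-th optimal polynomial approximant $q_{n,p}[g]$ to $1/g$ in $H^p$ is the unique element of $\mathcal{P}_n$ with $\|1-q_{n,p}[g]g\|_p=\inf_{q\in\mathcal{P}_n}\|1-qg\|_p$. *)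

theory Defs
  imports "HOL-Complex_Analysis.Complex_Analysis"
begin

(* Functions on the unit disk are total functions complex => complex; all notions below only
   depend on the values in ball 0 1. *)

definition hardy_mean :: "real \<Rightarrow> (complex \<Rightarrow> complex) \<Rightarrow> real \<Rightarrow> real" where
  "hardy_mean p f r =
     1 / (2 * pi) * integral {0..2 * pi} (\<lambda>\<theta>. norm (f (of_real r * cis \<theta>)) powr p)"

definition hardy_space :: "real \<Rightarrow> (complex \<Rightarrow> complex) set" where
  "hardy_space p =
     {f. f holomorphic_on ball 0 1 \<and> bdd_above (hardy_mean p f ` {0<..<1})}"

(* Meaningful for f in hardy_space p only: the supremum of an unbounded set of reals is
   unspecified. *)
definition hardy_norm :: "real \<Rightarrow> (complex \<Rightarrow> complex) \<Rightarrow> real" where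
  "hardy_norm p f = (SUP r\<in>{0<..<1}. hardy_mean p f r) powr (1 / p)"

definition hardy_space_infinity :: "(complex \<Rightarrow> complex) set" where
  "hardy_space_infinity = {f. f holomorphic_on ball 0 1 \<and> bounded (f ` ball 0 1)}"

(* Boundary values are radial limits, which exist almost everywhere by Fatou's theorem. *)
definition inner_function :: "(complex \<Rightarrow> complex) \<Rightarrow> bool" where
  "inner_function J \<longleftrightarrow> J \<in> hardy_space_infinity \<and>
     (AE \<theta> in lebesgue_on {0..2 * pi}.
        \<exists>l. ((\<lambda>r. J (of_real r * cis \<theta>)) \<longlongrightarrow> l) (at_left (1::real)) \<and> norm l = 1)"

(* q is the n-th optimal polynomial approximant to 1/g. For 1 < p the minimizer exists and is
   unique, so this relation is the graph of the approximant as a function of g; uniqueness is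
   not part of the definition. *)
definition is_opa :: "real \<Rightarrow> nat \<Rightarrow> (complex \<Rightarrow> complex) \<Rightarrow> complex poly \<Rightarrow> bool" where
  "is_opa p n g q \<longleftrightarrow> degree q \<le> n \<and>
     hardy_norm p (\<lambda>z. 1 - poly q z * g z) =
       (INF s\<in>{s. degree s \<le> n}. hardy_norm p (\<lambda>z. 1 - poly s z * g z))"

end

theory Submission imports Defs begin

text \<open>
  The idea is to trade a zero of the approximant for a zero outside the disk. Suppose that the
  optimal polynomial approximant \<open>q\<close> has a zero \<open>w\<close> in the disk, say \<open>q = (z - w) * r\<close>. If
  \<open>w \<noteq> 0\<close>, divide by the Blaschke factor \<open>J = (z - w) / (1 - cnj w * z)\<close>: the quotient
  \<open>s = q / J = (1 - cnj w * z) * r\<close> is again a polynomial of degree at most \<open>n\<close>. The hypothesis,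
  applied to \<open>J\<close> and \<open>f = s * g\<close>, gives a constant \<open>c\<close> with
  \<open>\<parallel>1 - c * s * g\<parallel> \<le> \<parallel>1 - J * s * g\<parallel> = \<parallel>1 - q * g\<parallel>\<close>, so \<open>c * s\<close> is optimal as well. Optimal
  approximants are unique, hence \<open>q = c * s\<close> and \<open>z - w = c * (1 - cnj w * z)\<close>, which forces
  \<open>norm w = 1\<close>. A zero at the origin is excluded separately, because then \<open>J 0 = 0\<close>: if \<open>q 0 = 0\<close>,
  then \<open>1 - q * g\<close> has value \<open>1\<close> at the centre, so its norm is at least \<open>1\<close>, the norm obtained
  from the zero polynomial; uniqueness gives \<open>q = 0\<close>.

  What remains is uniqueness (\<open>is_opa_unique\<close>), that is, strict convexity of the norm. Since the
  norm is a supremum of means over circles, pointwise strict convexity of \<open>\<lambda>z. norm z powr p\<close> alone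
  does not survive the limit. A compactness argument turns it into the quantitative
  inequality \<open>uniform_convexity_pointwise\<close>, which can be integrated over circles. If two approximants \<open>q \<noteq> s\<close> are optimal, their midpoint has no smaller norm, and
  on circles where the mean of the midpoint is almost maximal the mean of \<open>(s - q) * g\<close> becomes
  arbitrarily small. These circles can be kept away from the centre
  (\<open>hardy_mean_sup_away_from_center\<close>), whereas the mean of \<open>(s - q) * g\<close> is bounded
  below there in terms of the nonzero value of \<open>(s - q) * g / z ^ k\<close> at the centre, with \<open>k\<close> the order of
  \<open>s - q\<close> at \<open>0\<close> (\<open>hardy_mean_poly_mult_bounded_below\<close>). The two facts are incompatible.
\<close>

section \<open>Quantitative convexity of powers of the modulus\<close>

text \<open>
  Strictness gives the positivity of midpoint gaps, and the tangent-line form gives Jensen's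
  inequality for circle means by plain integration. The values \<open>x = 0\<close> and \<open>t = 0\<close> are included
  because holomorphic functions may vanish.
\<close>

lemma powr_above_tangent:
  fixes x t p :: real
  assumes p: "1 < p" and "0 \<le> x" "0 \<le> t" "x \<noteq> t"
  shows "t powr p + p * t powr (p - 1) * (x - t) < x powr p"
proof (cases "x = 0 \<or> t = 0")
  case True
  then show ?thesis
  proof
    assume "x = 0"
    with assms have t: "0 < t" by simp
    have "t powr (p - 1) * t = t powr p"
      using t by (simp add: powr_mult_base mult.commute)
    moreover have "t powr p < p * t powr p" using p t by simp
    ultimately show ?thesis using \<open>x = 0\<close> by (simp add: mult.assoc)
  next
    assume "t = 0" with assms show ?thesis by simp
  qed
next
  case False
  with assms have x: "0 < x" and t: "0 < t" by auto
  have D: "((\<lambda>z. z powr p) has_real_derivative p * z powr (p - 1)) (at z)" if "0 < z" for z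
    using that by (auto intro!: derivative_eq_intros)
  show ?thesis
  proof (cases "t < x")
    case True
    obtain z where z: "t < z" "z < x" "x powr p - t powr p = (x - t) * (p * z powr (p - 1))"
      using MVT2[OF True, of "\<lambda>z. z powr p" "\<lambda>z. p * z powr (p - 1)"] D t by auto
    have "t powr (p - 1) < z powr (p - 1)" using z t p by (intro powr_less_mono2) auto
    then have "(x - t) * (p * t powr (p - 1)) < (x - t) * (p * z powr (p - 1))"
      using True p by simp
    with z show ?thesis by (simp add: algebra_simps)
  next
    case False
    with assms have lt: "x < t" by simp
    obtain z where z: "x < z" "z < t" "t powr p - x powr p = (t - x) * (p * z powr (p - 1))"
      using MVT2[OF lt, of "\<lambda>z. z powr p" "\<lambda>z. p * z powr (p - 1)"] D x by auto
    have "z powr (p - 1) < t powr (p - 1)" using z x p by (intro powr_less_mono2) auto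
    then have "(t - x) * (p * z powr (p - 1)) < (t - x) * (p * t powr (p - 1))"
      using lt p by simp
    with z show ?thesis by (simp add: algebra_simps)
  qed
qed

definition midpoint_gap :: "real \<Rightarrow> complex \<Rightarrow> complex \<Rightarrow> real" where
  "midpoint_gap p a b = (norm a powr p + norm b powr p) / 2 - norm ((a + b) / 2) powr p"

text \<open>
  If the moduli differ, the tangent inequality at their mean is strict. If they agree, the
  parallelogram law makes the triangle inequality strict.
\<close>

lemma midpoint_gap_pos:
  assumes p: "1 < p" and ab: "a \<noteq> b"
  shows "0 < midpoint_gap p a b"
proof -
  define t where "t = (norm a + norm b) / 2"
  have t0: "0 \<le> t" by (simp add: t_def)
  have le: "norm ((a + b) / 2) \<le> t"
    using norm_triangle_ineq[of a b] by (simp add: t_def norm_divide)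
  have mono: "norm ((a + b) / 2) powr p \<le> t powr p"
    using le p by (intro powr_mono2) auto
  show ?thesis
  proof (cases "norm a = norm b")
    case False
    then have "norm a \<noteq> t" "norm b \<noteq> t" by (auto simp: t_def field_simps)
    then have "t powr p + p * t powr (p - 1) * (norm a - t) < norm a powr p"
      "t powr p + p * t powr (p - 1) * (norm b - t) < norm b powr p"
      using powr_above_tangent[OF p] t0 by auto
    moreover have "p * t powr (p - 1) * (norm a - t) + p * t powr (p - 1) * (norm b - t) = 0"
      unfolding distrib_left[symmetric] by (simp add: t_def)
    ultimately show ?thesis using mono by (simp add: midpoint_gap_def)
  next
    case True
    have "norm ((a + b) / 2) \<noteq> norm a"
    proof
      assume "norm ((a + b) / 2) = norm a"
      then have "norm (a + b) = 2 * norm a" by (simp add: norm_divide)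
      moreover have "norm (a + b) ^ 2 + norm (a - b) ^ 2 = 2 * norm a ^ 2 + 2 * norm b ^ 2"
        unfolding cmod_power2 by (simp add: power2_eq_square algebra_simps)
      ultimately have "norm (a - b) ^ 2 = 0" using True by (simp add: power_mult_distrib)
      with ab show False by simp
    qed
    with le True have "norm ((a + b) / 2) < norm a" by (simp add: t_def)
    then have "norm ((a + b) / 2) powr p < norm a powr p"
      using p by (intro powr_less_mono2) auto
    with True show ?thesis by (simp add: midpoint_gap_def)
  qed
qed

lemma midpoint_gap_nonneg: "1 < p \<Longrightarrow> 0 \<le> midpoint_gap p a b"
  by (cases "a = b") (simp_all add: midpoint_gap_def[of p b b] less_imp_le[OF midpoint_gap_pos])

lemma midpoint_gap_scale:
  "midpoint_gap p (of_real k * a) (of_real k * b) = \<bar>k\<bar> powr p * midpoint_gap p a b"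
proof -
  have "(of_real k * a + of_real k * b) / 2 = of_real k * ((a + b) / 2)"
    by (simp add: algebra_simps)
  then show ?thesis
    by (simp add: midpoint_gap_def norm_mult powr_mult distrib_left right_diff_distrib del: times_divide_eq_right)
       (simp add: field_simps)
qed

text \<open>
  Both sides are homogeneous of degree \<open>p\<close>, so it suffices to find the constant on the unit sphere
  of pairs. Only pairs with \<open>norm (a - b) powr p\<close> at least \<open>e\<close> times the sum of powers need
  attention; they form a compact set avoiding the diagonal, on which the gap has a positive minimum.
\<close>

lemma uniform_convexity_pointwise:
  assumes p: "1 < p" and e: "0 < e"
  obtains C where "0 \<le> C"
    "\<And>a b :: complex. norm (a - b) powr p \<le> e * (norm a powr p + norm b powr p) + C * midpoint_gap p a b"
proof -
  define F where "F = (\<lambda>x :: complex \<times> complex.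
      norm (fst x - snd x) powr p - e * (norm (fst x) powr p + norm (snd x) powr p))"
  define G where "G = (\<lambda>x :: complex \<times> complex. midpoint_gap p (fst x) (snd x))"
  have contF: "continuous_on UNIV F"
    unfolding F_def using p by (intro continuous_intros continuous_on_powr') auto
  have contG: "continuous_on UNIV G"
    unfolding G_def midpoint_gap_def using p by (intro continuous_intros continuous_on_powr') auto
  define K where "K = sphere 0 1 \<inter> {x. 0 \<le> F x}"
  have "closed {x. 0 \<le> F x}"
    using contF by (intro closed_Collect_le) auto
  then have K: "compact K" unfolding K_def by (intro compact_Int_closed) auto
  obtain C where C0: "0 \<le> C" and C: "\<And>x. x \<in> K \<Longrightarrow> F x \<le> C * G x"
  proof (cases "K = {}")
    case True then show ?thesis using that[of 0] by auto
  next
    case False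
    obtain x0 where x0: "x0 \<in> K" "\<And>x. x \<in> K \<Longrightarrow> G x0 \<le> G x"
      using continuous_attains_inf[OF K False continuous_on_subset[OF contG]] by auto
    obtain x1 where x1: "x1 \<in> K" "\<And>x. x \<in> K \<Longrightarrow> F x \<le> F x1"
      using continuous_attains_sup[OF K False continuous_on_subset[OF contF]] by auto
    have "fst x0 \<noteq> snd x0"
    proof
      assume eq: "fst x0 = snd x0"
      have "x0 \<noteq> 0" using x0 by (auto simp: K_def)
      with eq have "0 < norm (fst x0) powr p" by (cases x0) (auto simp: zero_prod_def)
      with eq e have "F x0 < 0" by (simp add: F_def)
      with x0 show False by (simp add: K_def)
    qed
    then have G0: "0 < G x0" unfolding G_def using p by (intro midpoint_gap_pos)
    have F1: "0 \<le> F x1" using x1 by (simp add: K_def)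
    show ?thesis
    proof (rule that[of "F x1 / G x0"])
      show "0 \<le> F x1 / G x0" using G0 F1 by simp
      fix x assume x: "x \<in> K"
      have "F x \<le> F x1 / G x0 * G x0" using x1 x G0 by simp
      also have "\<dots> \<le> F x1 / G x0 * G x" using x0 x G0 F1 by (intro mult_left_mono) auto
      finally show "F x \<le> F x1 / G x0 * G x" .
    qed
  qed
  have unit: "F x \<le> C * G x" if "norm x = 1" for x
  proof (cases "x \<in> K")
    case False
    then have "F x < 0" using that by (simp add: K_def)
    moreover have "0 \<le> C * G x" using C0 p by (simp add: G_def midpoint_gap_nonneg)
    ultimately show ?thesis by simp
  qed (use C in auto)
  have "F (a, b) \<le> C * G (a, b)" for a b
  proof (cases "(a, b) = 0")
    case True
    then show ?thesis by (simp add: F_def G_def zero_prod_def midpoint_gap_def)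
  next
    case False
    define k where "k = norm (a, b)"
    define a' b' where "a' = of_real (1 / k) * a" and "b' = of_real (1 / k) * b"
    have k: "0 < k" using False unfolding k_def by (simp only: zero_less_norm_iff) simp
    have ab: "a = of_real k * a'" "b = of_real k * b'" using k by (auto simp: a'_def b'_def)
    have "(a', b') = (1 / k) *\<^sub>R (a, b)" by (simp add: a'_def b'_def scaleR_conv_of_real)
    then have "norm (a', b') = 1" using k by (simp only: norm_scaleR) (simp add: k_def)
    then have "F (a', b') \<le> C * G (a', b')" by (rule unit)
    then have "k powr p * F (a', b') \<le> k powr p * (C * G (a', b'))"
      by (intro mult_left_mono) auto
    moreover have "F (a, b) = k powr p * F (a', b')"
    proof -
      have "a - b = of_real k * (a' - b')" by (simp add: ab algebra_simps)
      then have "norm (a - b) powr p = k powr p * norm (a' - b') powr p"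
        using k by (simp add: norm_mult powr_mult)
      moreover have "norm a powr p = k powr p * norm a' powr p" "norm b powr p = k powr p * norm b' powr p"
        using k by (simp_all add: ab norm_mult powr_mult)
      ultimately show ?thesis by (simp add: F_def algebra_simps)
    qed
    moreover have "G (a, b) = k powr p * G (a', b')"
      using k by (simp add: G_def ab midpoint_gap_scale)
    ultimately show ?thesis by (simp add: mult_ac)
  qed
  then show ?thesis using C0 by (intro that[of C]) (auto simp: F_def G_def algebra_simps)
qed

section \<open>Means over circles\<close>

lemma circle_in_disc: "0 \<le> r \<Longrightarrow> r < 1 \<Longrightarrow> of_real r * cis \<theta> \<in> ball 0 1"
  by (simp add: norm_mult)

lemma continuous_on_circle_powr:
  assumes "0 < p" "f holomorphic_on ball 0 1" "0 \<le> r" "r < 1"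
  shows "continuous_on A (\<lambda>\<theta>. norm (f (of_real r * cis \<theta>)) powr p)"
proof -
  have "continuous_on A (\<lambda>\<theta>. f (of_real r * cis \<theta>))"
    by (rule continuous_on_compose2[OF holomorphic_on_imp_continuous_on[OF assms(2)]])
       (use assms circle_in_disc in \<open>auto intro!: continuous_intros\<close>)
  then show ?thesis using assms by (intro continuous_on_powr' continuous_intros) auto
qed

lemma has_integral_hardy_mean:
  assumes "0 < p" "f holomorphic_on ball 0 1" "0 \<le> r" "r < 1"
  shows "((\<lambda>\<theta>. norm (f (of_real r * cis \<theta>)) powr p) has_integral 2 * pi * hardy_mean p f r) {0..2 * pi}"
  using integrable_integral[OF integrable_continuous_real[OF continuous_on_circle_powr[OF assms]]]
  by (simp add: hardy_mean_def)

lemma hardy_mean_nonneg: "0 \<le> hardy_mean p f r"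
  unfolding hardy_mean_def by (cases "(\<lambda>\<theta>. norm (f (of_real r * cis \<theta>)) powr p) integrable_on {0..2 * pi}")
     (auto simp: integral_nonneg not_integrable_integral)

lemma hardy_mean_cong:
  assumes "\<And>z. z \<in> ball 0 1 \<Longrightarrow> f z = g z" "0 \<le> r" "r < 1"
  shows "hardy_mean p f r = hardy_mean p g r"
  using assms circle_in_disc by (simp add: hardy_mean_def)

lemma hardy_norm_cong:
  assumes "\<And>z. z \<in> ball 0 1 \<Longrightarrow> f z = g z"
  shows "hardy_norm p f = hardy_norm p g"
proof -
  have "hardy_mean p f ` {0<..<1} = hardy_mean p g ` {0<..<1}"
    by (intro image_cong refl hardy_mean_cong assms) auto
  then show ?thesis by (simp add: hardy_norm_def)
qed

lemma hardy_mean_affine_bound: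
  assumes p: "0 < p" and f: "f holomorphic_on ball 0 1" and g: "g holomorphic_on ball 0 1"
    and r: "0 \<le> r" "r < 1"
    and le: "\<And>z. z \<in> ball 0 1 \<Longrightarrow> norm (f z) powr p \<le> A + B * norm (g z) powr p"
  shows "hardy_mean p f r \<le> A + B * hardy_mean p g r"
proof -
  have "((\<lambda>\<theta>. A + B * norm (g (of_real r * cis \<theta>)) powr p) has_integral
      (2 * pi - 0) *\<^sub>R A + B * (2 * pi * hardy_mean p g r)) {0..2 * pi}"
    using has_integral_const_real[of A 0 "2 * pi"]
    by (intro has_integral_add has_integral_mult_right has_integral_hardy_mean p g r) auto
  with has_integral_hardy_mean[OF p f r]
  have "2 * pi * hardy_mean p f r \<le> (2 * pi - 0) *\<^sub>R A + B * (2 * pi * hardy_mean p g r)"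
    by (rule has_integral_le) (use le circle_in_disc[OF r] in blast)
  then have "2 * pi * hardy_mean p f r \<le> 2 * pi * (A + B * hardy_mean p g r)"
    by (simp only: distrib_left mult_ac real_scaleR_def diff_zero)
  then show ?thesis by simp
qed

text \<open>
  Integrate the tangent inequality at \<open>t = norm (f 0)\<close> over the circle: the linear term is
  nonnegative because the mean value property gives \<open>norm (f 0) \<le> hardy_mean 1 f r\<close>.
\<close>

lemma norm_center_powr_le_hardy_mean:
  assumes p: "1 < p" and f: "f holomorphic_on ball 0 1" and r: "0 < r" "r < 1"
  shows "norm (f 0) powr p \<le> hardy_mean p f r"
proof -
  define t where "t = norm (f 0)"
  define c where "c = p * t powr (p - 1)"
  have "f holomorphic_on cball 0 r" by (rule holomorphic_on_subset[OF f]) (use r in auto)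
  then have "((\<lambda>u. f u / u) has_contour_integral 2 * of_real pi * \<i> * f 0) (circlepath 0 r)"
    using Cauchy_integral_circlepath_simple[of f 0 r 0] r by simp
  then have "((\<lambda>\<theta>. f (of_real r * cis \<theta>) / (of_real r * cis \<theta>) * r * \<i> * cis \<theta>)
      has_integral 2 * of_real pi * \<i> * f 0) {0..2 * pi}"
    unfolding circlepath_def by (subst (asm) has_contour_integral_part_circlepath_iff) auto
  then have "((\<lambda>\<theta>. \<i> * f (of_real r * cis \<theta>)) has_integral 2 * of_real pi * \<i> * f 0) {0..2 * pi}"
    by (rule has_integral_eq[rotated]) (use r in \<open>simp add: field_simps\<close>)
  from has_integral_mult_right[OF this, of "- \<i>"]
  have mean: "((\<lambda>\<theta>. f (of_real r * cis \<theta>)) has_integral 2 * of_real pi * f 0) {0..2 * pi}"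
    by (simp add: mult_ac)
  have int1: "((\<lambda>\<theta>. norm (f (of_real r * cis \<theta>))) has_integral 2 * pi * hardy_mean 1 f r) {0..2 * pi}"
    using has_integral_hardy_mean[OF _ f, of 1 r] r by simp
  have "norm (2 * of_real pi * f 0) \<le> 2 * pi * hardy_mean 1 f r"
    using integral_norm_bound_integral[of "\<lambda>\<theta>. f (of_real r * cis \<theta>)" "{0..2*pi}" "\<lambda>\<theta>. norm (f (of_real r * cis \<theta>))"]
      mean int1 by (auto simp: integral_unique has_integral_integrable)
  then have t: "t \<le> hardy_mean 1 f r" by (simp add: norm_mult t_def)
  have "((\<lambda>\<theta>. (t powr p - c * t) + c * norm (f (of_real r * cis \<theta>))) has_integral
      (2 * pi - 0) *\<^sub>R (t powr p - c * t) + c * (2 * pi * hardy_mean 1 f r)) {0..2 * pi}"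
    using has_integral_const_real[of "t powr p - c * t" 0 "2 * pi"]
    by (intro has_integral_add has_integral_mult_right int1) auto
  moreover have "((\<lambda>\<theta>. norm (f (of_real r * cis \<theta>)) powr p) has_integral 2 * pi * hardy_mean p f r) {0..2 * pi}"
    using p r f by (intro has_integral_hardy_mean) auto
  moreover have "(t powr p - c * t) + c * x \<le> x powr p" if "0 \<le> x" for x
    using powr_above_tangent[OF p that, of t] by (cases "x = t") (auto simp: t_def c_def algebra_simps)
  ultimately have "(2 * pi - 0) *\<^sub>R (t powr p - c * t) + c * (2 * pi * hardy_mean 1 f r) \<le> 2 * pi * hardy_mean p f r"
    by (rule has_integral_le) auto
  then have "2 * pi * (t powr p - c * t + c * hardy_mean 1 f r) \<le> 2 * pi * hardy_mean p f r"
    by (simp add: algebra_simps)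
  then have "t powr p - c * t + c * hardy_mean 1 f r \<le> hardy_mean p f r"
    by (rule mult_left_le_imp_le) simp
  then have "t powr p + c * (hardy_mean 1 f r - t) \<le> hardy_mean p f r"
    by (simp add: right_diff_distrib)
  moreover have "0 \<le> c * (hardy_mean 1 f r - t)" using t p by (simp add: c_def)
  ultimately show ?thesis by (simp add: t_def)
qed

lemma hardy_mean_near_center:
  assumes p: "0 < p" and f: "f holomorphic_on ball 0 1" and less: "norm (f 0) powr p < y"
  obtains \<rho> where "0 < \<rho>" "\<rho> < 1" "\<And>r. 0 < r \<Longrightarrow> r < \<rho> \<Longrightarrow> hardy_mean p f r < y"
proof -
  define m where "m = (norm (f 0) powr p + y) / 2"
  have m: "norm (f 0) powr p < m" "m < y" using less by (auto simp: m_def)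
  have "continuous_on (ball 0 1) (\<lambda>z. norm (f z) powr p)"
    using p holomorphic_on_imp_continuous_on[OF f]
    by (intro continuous_on_powr' continuous_intros) auto
  then have "isCont (\<lambda>z. norm (f z) powr p) 0"
    by (simp add: continuous_on_eq_continuous_at)
  then have "((\<lambda>z. norm (f z) powr p) \<longlongrightarrow> norm (f 0) powr p) (nhds 0)"
    using tendsto_at_iff_tendsto_nhds[of "\<lambda>z. norm (f z) powr p" 0] by (simp add: isCont_def)
  then have "eventually (\<lambda>z. norm (f z) powr p < m) (nhds 0)"
    using m(1) by (rule order_tendstoD(2))
  then obtain d where d: "0 < d" "\<And>z. norm z < d \<Longrightarrow> norm (f z) powr p < m"
    unfolding eventually_nhds_metric by (auto simp: dist_norm)
  show ?thesis
  proof (rule that[of "min d (1/2)"])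
    fix r :: real assume r: "0 < r" "r < min d (1/2)"
    have "((\<lambda>\<theta>. norm (f (of_real r * cis \<theta>)) powr p) has_integral 2 * pi * hardy_mean p f r) {0..2 * pi}"
      using p r f by (intro has_integral_hardy_mean) auto
    moreover have "((\<lambda>\<theta>. m) has_integral 2 * pi * m) {0..2 * pi}"
      using has_integral_const_real[of m 0 "2 * pi"] by simp
    ultimately have "2 * pi * hardy_mean p f r \<le> 2 * pi * m"
      by (rule has_integral_le) (use d r in \<open>simp add: norm_mult less_imp_le\<close>)
    with m show "hardy_mean p f r < y" by simp
  qed (use d in auto)
qed

text \<open>
  Near the centre the means are close to \<open>norm (f 0) powr p\<close>, so small radii can compete for the
  supremum only if it equals \<open>norm (f 0) powr p\<close>. This value bounds every circle mean from below,
  so in that case every circle attains the supremum.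
\<close>

lemma hardy_mean_sup_away_from_center:
  assumes p: "1 < p" and f: "f \<in> hardy_space p"
  obtains \<rho> where "0 < \<rho>"
    "\<And>e. 0 < e \<Longrightarrow> \<exists>r. \<rho> \<le> r \<and> r < 1 \<and> (SUP r\<in>{0<..<1}. hardy_mean p f r) - e < hardy_mean p f r"
proof -
  define S where "S = (SUP r\<in>{0<..<1}. hardy_mean p f r)"
  have hol: "f holomorphic_on ball 0 1" and bdd: "bdd_above (hardy_mean p f ` {0<..<1})"
    using f by (auto simp: hardy_space_def)
  have ex: "\<exists>r. 0 < r \<and> r < 1 \<and> y < hardy_mean p f r" if "y < S" for y
    using that bdd unfolding S_def by (subst (asm) less_cSUP_iff) auto
  show ?thesis
  proof (cases "norm (f 0) powr p < S")
    case True
    then have "norm (f 0) powr p < (norm (f 0) powr p + S) / 2" by simp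
    then obtain \<rho> where \<rho>: "0 < \<rho>"
        "\<And>r. 0 < r \<Longrightarrow> r < \<rho> \<Longrightarrow> hardy_mean p f r < (norm (f 0) powr p + S) / 2"
      using p by (elim hardy_mean_near_center[OF _ hol, rotated]) auto
    show ?thesis
    proof (rule that[OF \<rho>(1)])
      fix e :: real assume "0 < e"
      then have "max (S - e) ((norm (f 0) powr p + S) / 2) < S" using True by simp
      then obtain r where r: "0 < r" "r < 1"
          "max (S - e) ((norm (f 0) powr p + S) / 2) < hardy_mean p f r"
        using ex by blast
      have "\<not> r < \<rho>"
      proof
        assume "r < \<rho>"
        from \<rho>(2)[OF r(1) this] r(3) show False by simp
      qed
      with r show "\<exists>r. \<rho> \<le> r \<and> r < 1 \<and> (SUP r\<in>{0<..<1}. hardy_mean p f r) - e < hardy_mean p f r"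
        unfolding S_def[symmetric] by (intro exI[of _ r]) simp
    qed
  next
    case False
    then have "S \<le> hardy_mean p f (1/2)"
      using norm_center_powr_le_hardy_mean[OF p hol, of "1/2"] by simp
    show ?thesis
    proof (rule that[of "1/2"])
      fix e :: real assume "0 < e"
      with \<open>S \<le> hardy_mean p f (1/2)\<close>
      show "\<exists>r. 1/2 \<le> r \<and> r < 1 \<and> (SUP r\<in>{0<..<1}. hardy_mean p f r) - e < hardy_mean p f r"
        unfolding S_def[symmetric] by (intro exI[of _ "1/2"]) simp
    qed simp
  qed
qed

section \<open>Membership in the Hardy space\<close>

lemma hardy_space_affine_bound:
  assumes p: "0 < p" and f: "f holomorphic_on ball 0 1" and g: "g \<in> hardy_space p" and B: "0 \<le> B"
    and le: "\<And>z. z \<in> ball 0 1 \<Longrightarrow> norm (f z) powr p \<le> A + B * norm (g z) powr p"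
  shows "f \<in> hardy_space p"
proof -
  have hol: "g holomorphic_on ball 0 1" and "bdd_above (hardy_mean p g ` {0<..<1})"
    using g by (auto simp: hardy_space_def)
  then obtain M where M: "\<forall>y\<in>hardy_mean p g ` {0<..<1}. y \<le> M"
    unfolding bdd_above_def by blast
  have "hardy_mean p f r \<le> A + B * M" if "r \<in> {0<..<1}" for r
  proof -
    have "hardy_mean p f r \<le> A + B * hardy_mean p g r"
      using that by (intro hardy_mean_affine_bound[OF p f hol _ _ le]) auto
    also have "\<dots> \<le> A + B * M"
      using M that B by (intro add_left_mono mult_left_mono) auto
    finally show ?thesis .
  qed
  then have "bdd_above (hardy_mean p f ` {0<..<1})" by (rule bdd_aboveI2)
  with f show ?thesis by (simp add: hardy_space_def)
qed

lemma hardy_space_mult_poly: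
  assumes p: "0 < p" and g: "g \<in> hardy_space p"
  shows "(\<lambda>z. poly s z * g z) \<in> hardy_space p"
proof -
  have "compact (poly s ` cball 0 1)"
    by (intro compact_continuous_image continuous_intros) auto
  then have "bounded (poly s ` cball 0 1)" by (rule compact_imp_bounded)
  then obtain B where B: "\<And>z. z \<in> cball 0 1 \<Longrightarrow> norm (poly s z) \<le> B"
    unfolding bounded_iff by blast
  show ?thesis
  proof (rule hardy_space_affine_bound[OF p _ g, of _ "B powr p" 0])
    show "(\<lambda>z. poly s z * g z) holomorphic_on ball 0 1"
      using g by (intro holomorphic_intros) (simp add: hardy_space_def)
    fix z :: complex assume "z \<in> ball 0 1"
    with B[of z] p show "norm (poly s z * g z) powr p \<le> 0 + B powr p * norm (g z) powr p"
      by (auto simp: norm_mult powr_mult intro!: mult_right_mono powr_mono2)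
  qed simp
qed

lemma hardy_space_one_minus:
  assumes p: "0 < p" and h: "h \<in> hardy_space p"
  shows "(\<lambda>z. 1 - h z) \<in> hardy_space p"
proof (rule hardy_space_affine_bound[OF p _ h, of _ "2 powr p" "2 powr p"])
  show "(\<lambda>z. 1 - h z) holomorphic_on ball 0 1"
    using h by (intro holomorphic_intros) (simp add: hardy_space_def)
  fix z :: complex
  have "norm (1 - h z) \<le> 2 * max 1 (norm (h z))"
    using norm_triangle_ineq4[of 1 "h z"] by simp
  then have "norm (1 - h z) powr p \<le> (2 * max 1 (norm (h z))) powr p"
    using p by (intro powr_mono2) auto
  also have "\<dots> \<le> 2 powr p + 2 powr p * norm (h z) powr p"
    by (auto simp: powr_mult max_def)
  finally show "norm (1 - h z) powr p \<le> 2 powr p + 2 powr p * norm (h z) powr p" .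
qed simp

section \<open>Uniqueness of optimal approximants\<close>

lemma hardy_mean_uniform_convexity:
  assumes p: "1 < p" and e: "0 < e"
  obtains C where "0 \<le> C"
    "\<And>f g r. \<lbrakk>f holomorphic_on ball 0 1; g holomorphic_on ball 0 1; 0 < r; r < 1\<rbrakk> \<Longrightarrow>
       hardy_mean p (\<lambda>z. f z - g z) r \<le> e * (hardy_mean p f r + hardy_mean p g r) +
         C * ((hardy_mean p f r + hardy_mean p g r) / 2 - hardy_mean p (\<lambda>z. (f z + g z) / 2) r)"
proof -
  obtain C where C: "0 \<le> C" "\<And>a b :: complex.
      norm (a - b) powr p \<le> e * (norm a powr p + norm b powr p) + C * midpoint_gap p a b"
    using uniform_convexity_pointwise[OF p e] by blast
  show ?thesis
  proof (rule that[OF C(1)])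
    fix f g :: "complex \<Rightarrow> complex" and r :: real
    assume f: "f holomorphic_on ball 0 1" and g: "g holomorphic_on ball 0 1" and r: "0 < r" "r < 1"
    define M where "M = (\<lambda>h. hardy_mean p h r)"
    have I: "((\<lambda>\<theta>. norm (h (of_real r * cis \<theta>)) powr p) has_integral 2 * pi * M h) {0..2 * pi}"
      if "h holomorphic_on ball 0 1" for h
      unfolding M_def using p r that by (intro has_integral_hardy_mean) auto
    have "((\<lambda>\<theta>. norm (f (of_real r * cis \<theta>) - g (of_real r * cis \<theta>)) powr p)
        has_integral 2 * pi * M (\<lambda>z. f z - g z)) {0..2 * pi}"
      by (intro I holomorphic_intros f g)
    moreover have "((\<lambda>\<theta>. e * (norm (f (of_real r * cis \<theta>)) powr p + norm (g (of_real r * cis \<theta>)) powr p) +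
          C * midpoint_gap p (f (of_real r * cis \<theta>)) (g (of_real r * cis \<theta>)))
        has_integral e * (2 * pi * M f + 2 * pi * M g) +
          C * ((2 * pi * M f + 2 * pi * M g) / 2 - 2 * pi * M (\<lambda>z. (f z + g z) / 2))) {0..2 * pi}"
      unfolding midpoint_gap_def
      by (intro has_integral_add has_integral_diff has_integral_mult_right has_integral_divide I
          holomorphic_intros f g) auto
    ultimately have "2 * pi * M (\<lambda>z. f z - g z) \<le> e * (2 * pi * M f + 2 * pi * M g) +
          C * ((2 * pi * M f + 2 * pi * M g) / 2 - 2 * pi * M (\<lambda>z. (f z + g z) / 2))"
      by (rule has_integral_le) (rule C(2))
    also have "\<dots> = 2 * pi * (e * (M f + M g) + C * ((M f + M g) / 2 - M (\<lambda>z. (f z + g z) / 2)))"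
      by (simp add: field_simps)
    finally have "M (\<lambda>z. f z - g z) \<le> e * (M f + M g) + C * ((M f + M g) / 2 - M (\<lambda>z. (f z + g z) / 2))"
      by (rule mult_left_le_imp_le) simp
    then show "hardy_mean p (\<lambda>z. f z - g z) r \<le> e * (hardy_mean p f r + hardy_mean p g r) +
         C * ((hardy_mean p f r + hardy_mean p g r) / 2 - hardy_mean p (\<lambda>z. (f z + g z) / 2) r)"
      by (simp add: M_def)
  qed
qed

lemma hardy_norm_powr:
  assumes p: "0 < p" and f: "f \<in> hardy_space p"
  shows "hardy_norm p f powr p = (SUP r\<in>{0<..<1}. hardy_mean p f r)"
proof -
  have bdd: "bdd_above (hardy_mean p f ` {0<..<1})" using f by (simp add: hardy_space_def)
  have "hardy_mean p f (1/2) \<le> (SUP r\<in>{0<..<1}. hardy_mean p f r)"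
    by (rule cSUP_upper[OF _ bdd]) auto
  with hardy_mean_nonneg[of p f "1/2"] have "0 \<le> (SUP r\<in>{0<..<1}. hardy_mean p f r)" by linarith
  with p show ?thesis by (simp add: hardy_norm_def powr_powr)
qed

lemma hardy_mean_le_norm_powr:
  assumes p: "0 < p" and f: "f \<in> hardy_space p" and r: "0 < r" "r < 1"
  shows "hardy_mean p f r \<le> hardy_norm p f powr p"
  unfolding hardy_norm_powr[OF p f]
  by (rule cSUP_upper) (use f r in \<open>auto simp: hardy_space_def\<close>)

text \<open>
  This replaces strict convexity of the norm. Where the mean of the midpoint is within \<open>d\<close> of its
  supremum \<open>S\<close>, the integrated midpoint gap is below \<open>d\<close>, as the means of \<open>f\<close> and \<open>g\<close> are at most
  \<open>S\<close>; integrated uniform convexity then controls the mean of \<open>f - g\<close>.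
\<close>

lemma hardy_mean_diff_small_if_midpoint_norm_maximal:
  assumes p: "1 < p" and f: "f \<in> hardy_space p" and g: "g \<in> hardy_space p"
    and m: "(\<lambda>z. (f z + g z) / 2) \<in> hardy_space p"
    and fm: "hardy_norm p f \<le> hardy_norm p (\<lambda>z. (f z + g z) / 2)"
    and gm: "hardy_norm p g \<le> hardy_norm p (\<lambda>z. (f z + g z) / 2)"
  obtains \<rho> where "0 < \<rho>"
    "\<And>e. 0 < e \<Longrightarrow> \<exists>r. \<rho> \<le> r \<and> r < 1 \<and> hardy_mean p (\<lambda>z. f z - g z) r < e"
proof -
  define S where "S = hardy_norm p (\<lambda>z. (f z + g z) / 2) powr p"
  have p0: "0 < p" using p by simp
  have norm0: "0 \<le> hardy_norm p h" for h by (simp add: hardy_norm_def)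
  have S0: "0 \<le> S" by (simp add: S_def)
  have le: "hardy_mean p f r \<le> S" "hardy_mean p g r \<le> S" if "0 < r" "r < 1" for r
    using hardy_mean_le_norm_powr[OF p0 f that] hardy_mean_le_norm_powr[OF p0 g that]
      powr_mono2[OF _ norm0 fm, of p] powr_mono2[OF _ norm0 gm, of p] p0
    by (auto simp: S_def)
  obtain \<rho> where \<rho>: "0 < \<rho>"
    "\<And>d. 0 < d \<Longrightarrow> \<exists>r. \<rho> \<le> r \<and> r < 1 \<and> S - d < hardy_mean p (\<lambda>z. (f z + g z) / 2) r"
    using hardy_mean_sup_away_from_center[OF p m] unfolding S_def hardy_norm_powr[OF p0 m] by blast
  show ?thesis
  proof (rule that[OF \<rho>(1)])
    fix e :: real assume e: "0 < e"
    \<comment> \<open>The two error terms \<open>2 * \<epsilon> * S\<close> and \<open>C * d\<close>, with \<open>d = e / (2 * (C + 1))\<close>, are to be at most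
      \<open>e / 2\<close> each, the first strictly; adding \<open>1\<close> covers \<open>S = 0\<close> and \<open>C = 0\<close>.\<close>
    define \<epsilon> where "\<epsilon> = e / (4 * (S + 1))"
    have \<epsilon>: "0 < \<epsilon>" using e S0 by (simp add: \<epsilon>_def)
    obtain C where C: "0 \<le> C" "\<And>f g r. \<lbrakk>f holomorphic_on ball 0 1; g holomorphic_on ball 0 1; 0 < r; r < 1\<rbrakk> \<Longrightarrow>
       hardy_mean p (\<lambda>z. f z - g z) r \<le> \<epsilon> * (hardy_mean p f r + hardy_mean p g r) +
         C * ((hardy_mean p f r + hardy_mean p g r) / 2 - hardy_mean p (\<lambda>z. (f z + g z) / 2) r)"
      using hardy_mean_uniform_convexity[OF p \<epsilon>] by blast
    have "0 < e / (2 * (C + 1))" using e C(1) by simp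
    from \<rho>(2)[OF this] obtain r where r: "\<rho> \<le> r" "r < 1"
        "S - e / (2 * (C + 1)) < hardy_mean p (\<lambda>z. (f z + g z) / 2) r" by blast
    have r0: "0 < r" using r(1) \<rho>(1) by simp
    have half: "(a + b) / 2 - m \<le> d" if "a \<le> S" "b \<le> S" "S - d < m" for a b m d
      using that by (simp add: field_simps)
    have gap: "(hardy_mean p f r + hardy_mean p g r) / 2 - hardy_mean p (\<lambda>z. (f z + g z) / 2) r
        \<le> e / (2 * (C + 1))"
      by (rule half[OF le[OF r0 r(2)] r(3)])
    have "hardy_mean p (\<lambda>z. f z - g z) r \<le> \<epsilon> * (hardy_mean p f r + hardy_mean p g r) +
         C * ((hardy_mean p f r + hardy_mean p g r) / 2 - hardy_mean p (\<lambda>z. (f z + g z) / 2) r)"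
      using f g r0 r(2) by (intro C(2)) (auto simp: hardy_space_def)
    also have "\<dots> \<le> \<epsilon> * (S + S) + C * (e / (2 * (C + 1)))"
      using le[OF r0 r(2)] gap \<epsilon> C(1) by (intro add_mono mult_left_mono) auto
    also have "\<epsilon> * (S + S) < e / 2"
      using e S0 by (simp add: \<epsilon>_def field_simps)
    also have "C * (e / (2 * (C + 1))) \<le> e / 2"
      using e C(1) by (simp add: field_simps)
    finally show "\<exists>r. \<rho> \<le> r \<and> r < 1 \<and> hardy_mean p (\<lambda>z. f z - g z) r < e"
      using r by (intro exI[of _ r]) simp
  qed
qed

text \<open>
  On the circle of radius \<open>r\<close>, a factor \<open>z ^ k\<close> of \<open>d\<close> contributes the constant modulus \<open>r ^ k\<close>; what
  is left does not vanish at the centre, where its value bounds the mean from below.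
\<close>

lemma hardy_mean_poly_mult_bounded_below:
  assumes p: "1 < p" and d: "d \<noteq> 0" and g: "g holomorphic_on ball 0 1" and g0: "g 0 \<noteq> 0" and \<rho>: "0 < \<rho>"
  obtains e where "0 < e"
    "\<And>r. \<rho> \<le> r \<Longrightarrow> r < 1 \<Longrightarrow> e \<le> hardy_mean p (\<lambda>z. poly d z * g z) r"
proof -
  define k where "k = order 0 d"
  obtain w where w: "d = [:-0, 1:] ^ k * w" "\<not> [:-0, 1:] dvd w"
    using order_decomp[OF d, of 0] unfolding k_def by blast
  have w0: "poly w 0 \<noteq> 0" using w(2) unfolding poly_eq_0_iff_dvd by simp
  have hol: "(\<lambda>z. poly w z * g z) holomorphic_on ball 0 1" using g by (intro holomorphic_intros)
  show ?thesis
  proof (rule that)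
    show "0 < (\<rho> ^ k) powr p * norm (poly w 0 * g 0) powr p"
      using w0 g0 \<rho> by simp
    fix r assume r: "\<rho> \<le> r" "r < 1"
    have "hardy_mean p (\<lambda>z. poly d z * g z) r = (r ^ k) powr p * hardy_mean p (\<lambda>z. poly w z * g z) r"
      using r \<rho> by (simp add: hardy_mean_def w(1) norm_mult norm_power powr_mult mult.assoc)
    moreover have "norm (poly w 0 * g 0) powr p \<le> hardy_mean p (\<lambda>z. poly w z * g z) r"
      using norm_center_powr_le_hardy_mean[OF p hol] r \<rho> by simp
    moreover have "(\<rho> ^ k) powr p \<le> (r ^ k) powr p"
      using r \<rho> p by (intro powr_mono2 power_mono) auto
    ultimately show "(\<rho> ^ k) powr p * norm (poly w 0 * g 0) powr p \<le> hardy_mean p (\<lambda>z. poly d z * g z) r"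
      by (simp add: mult_mono)
  qed
qed

lemma is_opa_le:
  assumes "is_opa p n g q" "degree s \<le> n"
  shows "hardy_norm p (\<lambda>z. 1 - poly q z * g z) \<le> hardy_norm p (\<lambda>z. 1 - poly s z * g z)"
proof -
  have "bdd_below ((\<lambda>s. hardy_norm p (\<lambda>z. 1 - poly s z * g z)) ` {s. degree s \<le> n})"
    by (rule bdd_belowI2[of _ 0]) (simp add: hardy_norm_def)
  then show ?thesis using assms unfolding is_opa_def by (auto intro: cINF_lower)
qed

lemma is_opa_if_le_opa:
  assumes q: "is_opa p n g q" and s: "degree s \<le> n"
    and le: "hardy_norm p (\<lambda>z. 1 - poly s z * g z) \<le> hardy_norm p (\<lambda>z. 1 - poly q z * g z)"
  shows "is_opa p n g s"
  using le is_opa_le[OF q s] q s by (simp add: is_opa_def)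

lemma is_opa_unique:
  assumes p: "1 < p" and g: "g \<in> hardy_space p" and g0: "g 0 \<noteq> 0"
    and q: "is_opa p n g q" and s: "is_opa p n g s"
  shows "q = s"
proof (rule ccontr)
  assume "q \<noteq> s"
  define t where "t = smult (1/2) (q + s)"
  define F where "F = (\<lambda>q z. 1 - poly q z * g z)"
  have p0: "0 < p" using p by simp
  have H: "F q \<in> hardy_space p" for q
    unfolding F_def by (intro hardy_space_one_minus hardy_space_mult_poly p0 g)
  have t: "(\<lambda>z. (F q z + F s z) / 2) = F t"
    by (auto simp: F_def t_def fun_eq_iff field_simps)
  have deg: "degree t \<le> n"
    using q s by (auto simp: t_def is_opa_def intro: order_trans[OF degree_smult_le] degree_add_le)
  have le: "hardy_norm p (F q) \<le> hardy_norm p (F t)" "hardy_norm p (F s) \<le> hardy_norm p (F t)"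
    unfolding F_def by (rule is_opa_le[OF _ deg], fact)+
  obtain \<rho> where \<rho>: "0 < \<rho>"
    "\<And>e. 0 < e \<Longrightarrow> \<exists>r. \<rho> \<le> r \<and> r < 1 \<and> hardy_mean p (\<lambda>z. F q z - F s z) r < e"
    using hardy_mean_diff_small_if_midpoint_norm_maximal[OF p H[of q] H[of s], unfolded t, OF H le]
    by blast
  have diff: "(\<lambda>z. F q z - F s z) = (\<lambda>z. poly (s - q) z * g z)"
    by (auto simp: F_def algebra_simps)
  have hol: "g holomorphic_on ball 0 1" and "s - q \<noteq> 0"
    using g \<open>q \<noteq> s\<close> by (auto simp: hardy_space_def)
  obtain e where "0 < e" "\<And>r. \<rho> \<le> r \<Longrightarrow> r < 1 \<Longrightarrow> e \<le> hardy_mean p (\<lambda>z. F q z - F s z) r"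
    using hardy_mean_poly_mult_bounded_below[OF p \<open>s - q \<noteq> 0\<close> hol g0 \<rho>(1)] unfolding diff by blast
  with \<rho>(2)[of e] show False by fastforce
qed

text \<open>
  The value of \<open>1 - q * g\<close> at the centre is \<open>1\<close>, so its norm is at least \<open>1\<close> and the zero polynomial
  does equally well.
\<close>

lemma is_opa_poly_0_eq_0:
  assumes p: "1 < p" and g: "g \<in> hardy_space p" and g0: "g 0 \<noteq> 0"
    and q: "is_opa p n g q" and q0: "poly q 0 = 0"
  shows "q = 0"
proof -
  have p0: "0 < p" using p by simp
  define h where "h = (\<lambda>z. 1 - poly q z * g z)"
  have h: "h \<in> hardy_space p"
    unfolding h_def by (intro hardy_space_one_minus hardy_space_mult_poly p0 g)
  have "norm (h 0) powr p \<le> hardy_mean p h (1/2)"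
    using h by (intro norm_center_powr_le_hardy_mean p) (auto simp: hardy_space_def)
  also have "\<dots> \<le> hardy_norm p h powr p"
    by (rule hardy_mean_le_norm_powr[OF p0 h]) auto
  finally have "1 powr p \<le> hardy_norm p h powr p" by (simp add: h_def q0)
  then have "1 \<le> hardy_norm p h"
    using p0 powr_less_mono2[of p "hardy_norm p h" 1] by (force simp: hardy_norm_def)
  moreover have "hardy_norm p (\<lambda>z. 1 - poly 0 z * g z) = 1"
    by (simp add: hardy_norm_def hardy_mean_def)
  ultimately have "is_opa p n g 0"
    by (intro is_opa_if_le_opa[OF q]) (simp_all add: h_def)
  from is_opa_unique[OF p g g0 q this] show ?thesis .
qed

section \<open>Exchanging a zero through a Blaschke factor\<close>

text \<open>
  On the unit circle \<open>cnj u * (u - w) = cnj (1 - cnj w * u)\<close>, so numerator and denominator have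
  the same modulus; the radial limits exist by continuity, as the denominator has no
  zero on the closed disk.
\<close>

lemma inner_function_Moebius:
  assumes w: "norm w < 1"
  shows "inner_function (Moebius_function 0 w)"
proof -
  have hol: "Moebius_function 0 w holomorphic_on ball 0 1"
    using w by (rule Moebius_function_holomorphic)
  have "bounded (Moebius_function 0 w ` ball 0 1)"
    unfolding bounded_iff using Moebius_function_norm_lt_1[OF w] by (intro exI[of _ 1]) (force simp: less_imp_le)
  moreover have "\<exists>l. ((\<lambda>r. Moebius_function 0 w (of_real r * cis \<theta>)) \<longlongrightarrow> l) (at_left (1::real)) \<and> norm l = 1" for \<theta>
  proof -
    define u where "u = cis \<theta>"
    have u: "norm u = 1" "cnj u * u = 1" by (auto simp: u_def cis_cnj cis_mult)
    have eq: "norm (1 - cnj w * u) = norm (u - w)"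
    proof -
      have "norm (u - w) = norm (cnj u * (u - w))" using u by (simp add: norm_mult)
      also have "cnj u * (u - w) = cnj (1 - cnj w * u)" using u by (simp add: algebra_simps)
      finally show ?thesis by (simp only: complex_mod_cnj)
    qed
    have "u \<noteq> w" using u w by auto
    then have "norm (1 - cnj w * u) \<noteq> 0" unfolding eq by simp
    then have nz: "1 - cnj w * u \<noteq> 0" unfolding norm_eq_zero .
    have "((\<lambda>r. Moebius_function 0 w (of_real r * u)) \<longlongrightarrow> (of_real 1 * u - w) / (1 - cnj w * (of_real 1 * u))) (at_left (1::real))"
      unfolding Moebius_function_simple using nz by (intro tendsto_intros) auto
    moreover have "norm ((of_real 1 * u - w) / (1 - cnj w * (of_real 1 * u))) = 1"
      using \<open>u \<noteq> w\<close> by (simp add: norm_divide eq)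
    ultimately show ?thesis unfolding u_def by blast
  qed
  ultimately show ?thesis using hol by (simp add: inner_function_def hardy_space_infinity_def)
qed

theorem proposition4p2:
  fixes p :: real
  assumes "1 < p"
    and "\<forall>f J. f \<in> hardy_space p \<longrightarrow> f 0 \<noteq> 0 \<longrightarrow>
           inner_function J \<longrightarrow> \<not> J constant_on ball 0 1 \<longrightarrow> J 0 \<noteq> 0 \<longrightarrow>
           (\<exists>c. c \<noteq> 0 \<and>
              hardy_norm p (\<lambda>z. 1 - J z * f z) \<ge> hardy_norm p (\<lambda>z. 1 - c * f z))"
  shows "\<forall>g \<in> hardy_space p. g 0 \<noteq> 0 \<longrightarrow>
           (\<forall>n q. is_opa p n g q \<longrightarrow> q \<noteq> 0 \<longrightarrow> (\<forall>z \<in> ball 0 1. poly q z \<noteq> 0))"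
proof (intro ballI impI allI notI)
  fix g n q w
  assume g: "g \<in> hardy_space p" and g0: "g 0 \<noteq> 0" and q: "is_opa p n g q" and "q \<noteq> 0"
    and "w \<in> ball 0 1" and qw: "poly q w = 0"
  have w: "norm w < 1" using \<open>w \<in> ball 0 1\<close> by simp
  have q0: "poly q 0 \<noteq> 0" using is_opa_poly_0_eq_0[OF assms(1) g g0 q] \<open>q \<noteq> 0\<close> by blast
  with qw have w0: "w \<noteq> 0" by auto
  obtain r where r: "q = [:-w, 1:] * r" using qw unfolding poly_eq_0_iff_dvd by (rule dvdE)
  have r0: "r \<noteq> 0" using r \<open>q \<noteq> 0\<close> by auto
  \<comment> \<open>The polynomial \<open>q\<close> divided by the Blaschke factor of its zero.\<close>
  define s where "s = [:1, - cnj w:] * r"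
  define J where "J = Moebius_function 0 w"
  have J0: "J 0 \<noteq> 0" using w0 by (simp add: J_def Moebius_function_of_zero)
  have "J w = 0" by (simp add: J_def Moebius_function_eq_zero)
  with J0 w have nonconst: "\<not> J constant_on ball 0 1"
    unfolding constant_on_def by (metis centre_in_ball mem_ball_0 zero_less_one)
  have Js: "J z * (poly s z * g z) = poly q z * g z" if "z \<in> ball 0 1" for z
  proof -
    have "norm (cnj w * z) < 1 * 1"
      unfolding norm_mult using w that by (intro mult_strict_mono') auto
    then have "1 - cnj w * z \<noteq> 0" by auto
    then show ?thesis
      by (simp add: J_def Moebius_function_simple s_def r field_simps)
  qed
  have "(\<lambda>z. poly s z * g z) \<in> hardy_space p"
    using assms(1) g by (intro hardy_space_mult_poly) auto
  moreover have "poly s 0 * g 0 \<noteq> 0" using q0 g0 by (auto simp: s_def r)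
  moreover have "inner_function J" unfolding J_def using w by (rule inner_function_Moebius)
  ultimately obtain c where c: "c \<noteq> 0"
      "hardy_norm p (\<lambda>z. 1 - c * (poly s z * g z)) \<le> hardy_norm p (\<lambda>z. 1 - J z * (poly s z * g z))"
    using assms(2) nonconst J0 by blast
  have "hardy_norm p (\<lambda>z. 1 - J z * (poly s z * g z)) = hardy_norm p (\<lambda>z. 1 - poly q z * g z)"
    by (rule hardy_norm_cong) (simp add: Js)
  with c have le: "hardy_norm p (\<lambda>z. 1 - poly (smult c s) z * g z) \<le> hardy_norm p (\<lambda>z. 1 - poly q z * g z)"
    by (simp add: mult.assoc)
  have "degree q = 1 + degree r" unfolding r using r0 by (subst degree_mult_eq) auto
  moreover have "degree s \<le> 1 + degree r"
    unfolding s_def by (rule order_trans[OF degree_mult_le]) simp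
  ultimately have "degree (smult c s) \<le> n" using q by (simp add: is_opa_def)
  from is_opa_if_le_opa[OF q this le] have "q = smult c s"
    by (rule is_opa_unique[OF assms(1) g g0 q])
  \<comment> \<open>Cancelling \<open>r\<close> leaves \<open>z - w = c * (1 - cnj w * z)\<close>, whose roots \<open>w\<close> and \<open>1 / cnj w\<close> would coincide.\<close>
  then have "[:-w, 1:] * r = smult c [:1, - cnj w:] * r"
    unfolding s_def mult_smult_left r[symmetric] .
  then have "[:-w, 1:] = smult c [:1, - cnj w:]" using r0 by (simp only: mult_cancel_right) simp
  then have c_eq: "c = - w" and "1 = - c * cnj w" by simp_all
  then have "w * cnj w = 1" unfolding c_eq by simp
  then have "norm w ^ 2 = 1" using complex_norm_square[of w] by (metis of_real_1 of_real_eq_iff)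
  with w abs_square_less_1[of "norm w"] show False by simp
qed

end
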